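(* Let $A$ be an $A_\infty$-algebra over a field $\mathbb{K}$, $m\ge2$, and $\alpha_1,\dots,\alpha_m\in\mathrm{H}(A)$. If $\bar b_{j-i}(\alpha_{i+1},\dots,\alpha_j)=0$ for any $i,j$ satisfying $0\le i<j\le m$, $j-i<m$, then the Massey product of $\alpha_1,\dots,\alpha_m$ is defined and $\bar b_m(\alpha_1,\dots,\alpha_m)\in\langle\alpha_1,\dots,\alpha_m\rangle$.
   Context: $A_\infty$-algebra: a $\mathbb{Z}$- or $\mathbb{Z}_2$-graded $\mathbb{K}$-vector space $A$ with graded multilinear maps $b_n\colon A^{\otimes n}\to A$ ($n\ge1$) of degree $1$ such that for each $n\ge1$, $\sum_{r,t\ge0,\,s\ge1,\,r+s+t=n}b_{r+1+t}\circ(1^{\otimes r}\otimes b_s\otimes1^{\otimes t})=0$ (Koszul sign rule $(f\otimes g)(x\otimes y)=(-1)^{|g||x|}f(x)\otimes g(y)$). $\mathrm{H}(A)$ is the cohomology of $(A,b_1)$. A morphism $f\colon A\to B$ is a family of multilinear maps $f_n\colon A^{\otimes n}\to B$ ($n\ge1$) of degree $0$ with, for each $n\ge1$, $\sum_{r,t\ge0,\,s\ge1,\,r+s+t=n}f_{r+1+t}\circ(1^{\otimes r}\otimes b^A_s\otimes1^{\otimes t})=\sum_{i_1+\cdots+i_r=n,\,i_j>0}b^B_r\circ(f_{i_1}\otimes\cdots\otimes f_{i_r})$. It is a quasi-isomorphism if $f_1$ is one. $A_\infty$-structure on cohomology: $\{\bar b_n\}$ denotes a fixed $A_\infty$-structure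 on $\mathrm{H}(A)$ with $\bar b_1=0$ and $\bar b_2$ induced by $b_2$, together with a quasi-isomorphism of $A_\infty$-algebras $q=\{q_n\}\colon(\mathrm{H}(A),\{\bar b_n\})\to(A,\{b_n\})$ lifting the identity of $\mathrm{H}(A)$, i.e. $q_1(\alpha)$ is a $b_1$-closed representative of $\alpha$ for every $\alpha\in\mathrm{H}(A)$. (Such data exist, and the structure is unique up to isomorphism of $A_\infty$-algebras.) $\mathrm{Mat}^{(m+1)}_+(A)$ is the space of strictly upper-triangular matrices $\mathbf{a}=(a_{ij})_{0\le i,j\le m}$ with entries in $A$. The product $\odot$ of matrices is $(\mathbf{a}\odot\mathbf{b})_{ij}=\sum_ka_{ik}\otimes b_{kj}$ (no signs); $b_n$ acts component-wise on matrices with entries in $A^{\otimes n}$. For $\mathbf{a}\in\mathrm{Mat}^{(m+1)}_+(A)$, $\partial_{\mathbf{a}}\mathbf{a}=\sum_{n\ge1}b_n(\underbrace{\mathbf{a}\odot\cdots\odot\mathbf{a}}_n)$ (a finite sum), and $\mathbf{a}\approx\mathbf{a}'$ means $a_{ij}=a'_{ij}$ for all $(i,j)\ne(0,m)$. For $m\ge2$, $\mathbf{a}\in\mathrm{Mat}^{(m+1)}_+(A)$ is a defining system for $\alpha_1,\dots,\alpha_m\in\mathrm{H}(A)$ if $\partial_{\mathbf{a}}\mathbf{a}\approx0$ and each $\alpha_i$ is represented by the (then closed) element $a_{i-1,i}$. Put $\mu(\mathbf{a})=(\partial_{\mathbf{a}}\mathbf{a})_{0m}\in A$, which is $b_1$-closed.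 The Massey product of $\alpha_1,\dots,\alpha_m$ is defined if a defining system exists; $\langle\alpha_1,\dots,\alpha_m\rangle\subset\mathrm{H}(A)$ is the set of classes $[\mu(\mathbf{a})]$ over all defining systems. *)

theory Defs
  imports "HOL-Algebra.Module" "HOL-Algebra.AbelCoset"
begin

section \<open>Graded vector spaces\<close>

text \<open>
  The grading group is \<open>\<int>/N\<int>\<close> with \<open>N = 0\<close> (a \<open>\<int>\<close>-grading) or \<open>N = 2\<close>
  (a \<open>\<int>\<^sub>2\<close>-grading). Degrees are integers; \<open>d\<close> and \<open>d mod N\<close> denote the same degree, where
  \<open>d mod 0 = d\<close>. The ring multiplication fields inherited from the record
  \<^typ>\<open>('k, 'a) module\<close> carry no meaning.
\<close>

record ('k, 'a) graded_module = "('k, 'a) module" +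
  part :: "int \<Rightarrow> 'a set"

definition degrees :: "int \<Rightarrow> int set" where
  "degrees N = range (\<lambda>d. d mod N)"

definition homogeneous_decomposition ::
  "int \<Rightarrow> ('k, 'a, 's) graded_module_scheme \<Rightarrow> 'a \<Rightarrow> (int \<Rightarrow> 'a) \<Rightarrow> bool" where
  "homogeneous_decomposition N V x c \<longleftrightarrow>
     (\<forall>d. c d \<in> part V d) \<and> (\<forall>d. d \<notin> degrees N \<longrightarrow> c d = \<zero>\<^bsub>V\<^esub>) \<and>
     finite {d. c d \<noteq> \<zero>\<^bsub>V\<^esub>} \<and> x = (\<Oplus>\<^bsub>V\<^esub>d \<in> {d. c d \<noteq> \<zero>\<^bsub>V\<^esub>}. c d)"

definition graded_vector_space ::
  "int \<Rightarrow> ('k, 'r) ring_scheme \<Rightarrow> ('k, 'a, 's) graded_module_scheme \<Rightarrow> bool" where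
  "graded_vector_space N K V \<longleftrightarrow>
     (N = 0 \<or> N = 2) \<and> field K \<and> module K V \<and>
     (\<forall>d. submodule (part V d) K V) \<and> (\<forall>d. part V d = part V (d mod N)) \<and>
     (\<forall>x \<in> carrier V. \<exists>!c. homogeneous_decomposition N V x c)"


section \<open>Graded multilinear maps\<close>

text \<open>
  A linear map on \<open>V\<^sup>\<otimes>\<^sup>n\<close> is given by the corresponding multilinear function on lists of
  length \<open>n\<close>.
\<close>

definition multilinear_map ::
  "('k, 'r) ring_scheme \<Rightarrow> ('k, 'a, 's) graded_module_scheme \<Rightarrow> ('k, 'c, 't) graded_module_scheme
    \<Rightarrow> nat \<Rightarrow> ('a list \<Rightarrow> 'c) \<Rightarrow> bool" where
  "multilinear_map K V W n f \<longleftrightarrow>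
     (\<forall>xs. length xs = n \<and> set xs \<subseteq> carrier V \<longrightarrow>
        f xs \<in> carrier W \<and>
        (\<forall>i < n. \<forall>x \<in> carrier V. \<forall>y \<in> carrier V.
           f (xs[i := x \<oplus>\<^bsub>V\<^esub> y]) = f (xs[i := x]) \<oplus>\<^bsub>W\<^esub> f (xs[i := y])) \<and>
        (\<forall>i < n. \<forall>k \<in> carrier K. \<forall>x \<in> carrier V.
           f (xs[i := k \<odot>\<^bsub>V\<^esub> x]) = k \<odot>\<^bsub>W\<^esub> f (xs[i := x])))"

definition homogeneous_list ::
  "('k, 'a, 's) graded_module_scheme \<Rightarrow> 'a list \<Rightarrow> int list \<Rightarrow> bool" where
  "homogeneous_list V xs ds \<longleftrightarrow> list_all2 (\<lambda>x d. x \<in> part V d) xs ds"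

definition graded_multilinear_map ::
  "('k, 'r) ring_scheme \<Rightarrow> ('k, 'a, 's) graded_module_scheme \<Rightarrow> ('k, 'c, 't) graded_module_scheme
    \<Rightarrow> int \<Rightarrow> nat \<Rightarrow> ('a list \<Rightarrow> 'c) \<Rightarrow> bool" where
  "graded_multilinear_map K V W e n f \<longleftrightarrow>
     multilinear_map K V W n f \<and>
     (\<forall>xs ds. length xs = n \<and> homogeneous_list V xs ds \<longrightarrow> f xs \<in> part W (sum_list ds + e))"


section \<open>\<open>A\<^sub>\<infinity>\<close>-algebras and morphisms\<close>

definition parity_sign :: "('k, 'a, 's) graded_module_scheme \<Rightarrow> int \<Rightarrow> 'a \<Rightarrow> 'a" where
  "parity_sign V d x = (if even d then x else \<ominus>\<^bsub>V\<^esub> x)"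

definition insertions :: "nat \<Rightarrow> (nat \<times> nat \<times> nat) set" where
  "insertions n = {(r, s, t). 1 \<le> s \<and> r + s + t = n}"

text \<open>
  The value of \<open>\<Sum> g\<^sub>r\<^sub>+\<^sub>1\<^sub>+\<^sub>t \<circ> (1\<^sup>\<otimes>\<^sup>r \<otimes> b\<^sub>s \<otimes> 1\<^sup>\<otimes>\<^sup>t)\<close> at
  \<open>x\<^sub>1 \<otimes> \<dots> \<otimes> x\<^sub>n\<close> with \<open>x\<^sub>i\<close> homogeneous of degree \<open>d\<^sub>i\<close>. As \<open>b\<^sub>s\<close> has degree 1, moving it past
  \<open>x\<^sub>1, \<dots>, x\<^sub>r\<close> gives the Koszul sign \<open>(-1)\<^bsup>d\<^sub>1 + \<dots> + d\<^sub>r\<^esup>\<close>. By multilinearity, the identities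
  below are determined by their values on homogeneous elements.
\<close>

definition insertion_sum ::
  "('k, 'c, 't) graded_module_scheme \<Rightarrow> (nat \<Rightarrow> 'a list \<Rightarrow> 'c) \<Rightarrow> (nat \<Rightarrow> 'a list \<Rightarrow> 'a)
    \<Rightarrow> 'a list \<Rightarrow> int list \<Rightarrow> 'c" where
  "insertion_sum W g b xs ds =
     finsum W
       (\<lambda>(r, s, t). parity_sign W (sum_list (take r ds))
          (g (r + 1 + t) (take r xs @ [b s (take s (drop r xs))] @ drop (r + s) xs)))
       (insertions (length xs))"

definition ainf_algebra ::
  "int \<Rightarrow> ('k, 'r) ring_scheme \<Rightarrow> ('k, 'a, 's) graded_module_scheme
    \<Rightarrow> (nat \<Rightarrow> 'a list \<Rightarrow> 'a) \<Rightarrow> bool" where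
  "ainf_algebra N K A b \<longleftrightarrow>
     graded_vector_space N K A \<and>
     (\<forall>n \<ge> 1. graded_multilinear_map K A A 1 n (b n)) \<and>
     (\<forall>xs ds. xs \<noteq> [] \<and> homogeneous_list A xs ds \<longrightarrow> insertion_sum A b b xs ds = \<zero>\<^bsub>A\<^esub>)"

definition compositions :: "nat \<Rightarrow> nat list set" where
  "compositions n = {js. 0 \<notin> set js \<and> sum_list js = n}"

fun blocks :: "nat list \<Rightarrow> 'a list \<Rightarrow> 'a list list" where
  "blocks [] xs = []"
| "blocks (j # js) xs = take j xs # blocks js (drop j xs)"

definition ainf_morphism ::
  "('k, 'r) ring_scheme \<Rightarrow> ('k, 'a, 's) graded_module_scheme \<Rightarrow> (nat \<Rightarrow> 'a list \<Rightarrow> 'a)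
    \<Rightarrow> ('k, 'c, 't) graded_module_scheme \<Rightarrow> (nat \<Rightarrow> 'c list \<Rightarrow> 'c)
    \<Rightarrow> (nat \<Rightarrow> 'a list \<Rightarrow> 'c) \<Rightarrow> bool" where
  "ainf_morphism K A bA B bB f \<longleftrightarrow>
     (\<forall>n \<ge> 1. graded_multilinear_map K A B 0 n (f n)) \<and>
     (\<forall>xs ds. xs \<noteq> [] \<and> homogeneous_list A xs ds \<longrightarrow>
        insertion_sum B f bA xs ds =
        (\<Oplus>\<^bsub>B\<^esub>js \<in> compositions (length xs). bB (length js) (map2 f js (blocks js xs))))"


section \<open>Cohomology\<close>

definition cocycles :: "('k, 'a, 's) graded_module_scheme \<Rightarrow> (nat \<Rightarrow> 'a list \<Rightarrow> 'a) \<Rightarrow> 'a set" where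
  "cocycles A b = {x \<in> carrier A. b 1 [x] = \<zero>\<^bsub>A\<^esub>}"

definition coboundaries :: "('k, 'a, 's) graded_module_scheme \<Rightarrow> (nat \<Rightarrow> 'a list \<Rightarrow> 'a) \<Rightarrow> 'a set" where
  "coboundaries A b = (\<lambda>x. b 1 [x]) ` carrier A"

definition cohomology_class ::
  "('k, 'a, 's) graded_module_scheme \<Rightarrow> (nat \<Rightarrow> 'a list \<Rightarrow> 'a) \<Rightarrow> 'a \<Rightarrow> 'a set" where
  "cohomology_class A b x = coboundaries A b +>\<^bsub>A\<^esub> x"

text \<open>\<open>Ker b\<^sub>1 / Im b\<^sub>1\<close>, with elements the cosets of \<open>Im b\<^sub>1\<close>.\<close>

definition cohomology ::
  "('k, 'a, 's) graded_module_scheme \<Rightarrow> (nat \<Rightarrow> 'a list \<Rightarrow> 'a) \<Rightarrow> ('k, 'a set) graded_module" where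
  "cohomology A b =
     \<lparr>carrier = cohomology_class A b ` cocycles A b,
      mult = undefined, one = undefined,
      zero = coboundaries A b,
      add = set_add A,
      smult = (\<lambda>k X. \<Union>x \<in> X. cohomology_class A b (k \<odot>\<^bsub>A\<^esub> x)),
      part = (\<lambda>d. cohomology_class A b ` (cocycles A b \<inter> part A d))\<rparr>"

text \<open>
  The union below is over equal sets when \<open>f\<^sub>1\<close> is a chain map, so it is the class of the image of
  any representative.
\<close>

definition cohomology_map ::
  "('k, 'c, 't) graded_module_scheme \<Rightarrow> (nat \<Rightarrow> 'c list \<Rightarrow> 'c) \<Rightarrow> (nat \<Rightarrow> 'a list \<Rightarrow> 'c)
    \<Rightarrow> 'a set \<Rightarrow> 'c set" where
  "cohomology_map B bB f X = (\<Union>x \<in> X. cohomology_class B bB (f 1 [x]))"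

definition ainf_quasi_isomorphism ::
  "('k, 'r) ring_scheme \<Rightarrow> ('k, 'a, 's) graded_module_scheme \<Rightarrow> (nat \<Rightarrow> 'a list \<Rightarrow> 'a)
    \<Rightarrow> ('k, 'c, 't) graded_module_scheme \<Rightarrow> (nat \<Rightarrow> 'c list \<Rightarrow> 'c)
    \<Rightarrow> (nat \<Rightarrow> 'a list \<Rightarrow> 'c) \<Rightarrow> bool" where
  "ainf_quasi_isomorphism K A bA B bB f \<longleftrightarrow>
     ainf_morphism K A bA B bB f \<and>
     bij_betw (cohomology_map B bB f) (carrier (cohomology A bA)) (carrier (cohomology B bB))"

definition ainf_structure_on_cohomology ::
  "int \<Rightarrow> ('k, 'r) ring_scheme \<Rightarrow> ('k, 'a, 's) graded_module_scheme \<Rightarrow> (nat \<Rightarrow> 'a list \<Rightarrow> 'a)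
    \<Rightarrow> (nat \<Rightarrow> 'a set list \<Rightarrow> 'a set) \<Rightarrow> (nat \<Rightarrow> 'a set list \<Rightarrow> 'a) \<Rightarrow> bool" where
  "ainf_structure_on_cohomology N K A b bbar q \<longleftrightarrow>
     ainf_algebra N K (cohomology A b) bbar \<and>
     (\<forall>\<alpha> \<in> carrier (cohomology A b). bbar 1 [\<alpha>] = \<zero>\<^bsub>cohomology A b\<^esub>) \<and>
     (\<forall>x \<in> cocycles A b. \<forall>y \<in> cocycles A b.
        bbar 2 [cohomology_class A b x, cohomology_class A b y] = cohomology_class A b (b 2 [x, y])) \<and>
     ainf_quasi_isomorphism K (cohomology A b) bbar A b q \<and>
     (\<forall>\<alpha> \<in> carrier (cohomology A b).
        q 1 [\<alpha>] \<in> cocycles A b \<and> cohomology_class A b (q 1 [\<alpha>]) = \<alpha>)"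


section \<open>Massey products\<close>

text \<open>
  Matrices of size \<open>m + 1\<close> are functions of two indices, of which only the values at indices
  \<open>0, \<dots>, m\<close> matter.
\<close>

definition strictly_upper_triangular ::
  "('k, 'a, 's) graded_module_scheme \<Rightarrow> nat \<Rightarrow> (nat \<Rightarrow> nat \<Rightarrow> 'a) \<Rightarrow> bool" where
  "strictly_upper_triangular A m a \<longleftrightarrow>
     (\<forall>i \<le> m. \<forall>j \<le> m. a i j \<in> carrier A \<and> (j \<le> i \<longrightarrow> a i j = \<zero>\<^bsub>A\<^esub>))"

text \<open>
  The \<open>(i, j)\<close> entry of the \<open>n\<close>-fold product \<open>a \<odot> \<dots> \<odot> a\<close> is the sum of
  \<open>a\<^bsub>i k\<^sub>1\<^esub> \<otimes> a\<^bsub>k\<^sub>1 k\<^sub>2\<^esub> \<otimes> \<dots> \<otimes> a\<^bsub>k\<^sub>n\<^sub>-\<^sub>1 j\<^esub>\<close> over all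
  \<open>k\<^sub>1, \<dots>, k\<^sub>n\<^sub>-\<^sub>1 \<in> {0..m}\<close>; here \<open>b\<^sub>n\<close> has been applied to it.
\<close>

definition ainf_power_entry ::
  "('k, 'a, 's) graded_module_scheme \<Rightarrow> (nat \<Rightarrow> 'a list \<Rightarrow> 'a) \<Rightarrow> nat
    \<Rightarrow> (nat \<Rightarrow> nat \<Rightarrow> 'a) \<Rightarrow> nat \<Rightarrow> nat \<Rightarrow> nat \<Rightarrow> 'a" where
  "ainf_power_entry A b m a n i j =
     (\<Oplus>\<^bsub>A\<^esub>ks \<in> {ks. length ks = n - 1 \<and> set ks \<subseteq> {0..m}}. b n (map2 a (i # ks) (ks @ [j])))"

text \<open>
  The \<open>(i, j)\<close> entry of \<open>\<partial>\<^sub>a a\<close>. For a strictly upper triangular matrix of size \<open>m + 1\<close> the products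
  with more than \<open>m\<close> factors vanish, so the sum over all \<open>n \<ge> 1\<close> stops at \<open>m\<close>.
\<close>

definition self_differential ::
  "('k, 'a, 's) graded_module_scheme \<Rightarrow> (nat \<Rightarrow> 'a list \<Rightarrow> 'a) \<Rightarrow> nat
    \<Rightarrow> (nat \<Rightarrow> nat \<Rightarrow> 'a) \<Rightarrow> nat \<Rightarrow> nat \<Rightarrow> 'a" where
  "self_differential A b m a i j = (\<Oplus>\<^bsub>A\<^esub>n \<in> {1..m}. ainf_power_entry A b m a n i j)"

definition agree_off_corner :: "nat \<Rightarrow> (nat \<Rightarrow> nat \<Rightarrow> 'a) \<Rightarrow> (nat \<Rightarrow> nat \<Rightarrow> 'a) \<Rightarrow> bool" where
  "agree_off_corner m a a' \<longleftrightarrow> (\<forall>i \<le> m. \<forall>j \<le> m. (i, j) \<noteq> (0, m) \<longrightarrow> a i j = a' i j)"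

text \<open>The classes \<open>\<alpha>\<^sub>1, \<dots>, \<alpha>\<^sub>m\<close> are the values of \<open>\<alpha>\<close> at \<open>1, \<dots>, m\<close>.\<close>

definition defining_system ::
  "('k, 'a, 's) graded_module_scheme \<Rightarrow> (nat \<Rightarrow> 'a list \<Rightarrow> 'a) \<Rightarrow> nat
    \<Rightarrow> (nat \<Rightarrow> 'a set) \<Rightarrow> (nat \<Rightarrow> nat \<Rightarrow> 'a) \<Rightarrow> bool" where
  "defining_system A b m \<alpha> a \<longleftrightarrow>
     strictly_upper_triangular A m a \<and>
     agree_off_corner m (self_differential A b m a) (\<lambda>i j. \<zero>\<^bsub>A\<^esub>) \<and>
     (\<forall>i \<in> {1..m}. a (i - 1) i \<in> cocycles A b \<and> cohomology_class A b (a (i - 1) i) = \<alpha> i)"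

definition massey_defined ::
  "('k, 'a, 's) graded_module_scheme \<Rightarrow> (nat \<Rightarrow> 'a list \<Rightarrow> 'a) \<Rightarrow> nat \<Rightarrow> (nat \<Rightarrow> 'a set) \<Rightarrow> bool" where
  "massey_defined A b m \<alpha> \<longleftrightarrow> (\<exists>a. defining_system A b m \<alpha> a)"

definition massey_product ::
  "('k, 'a, 's) graded_module_scheme \<Rightarrow> (nat \<Rightarrow> 'a list \<Rightarrow> 'a) \<Rightarrow> nat \<Rightarrow> (nat \<Rightarrow> 'a set) \<Rightarrow> 'a set set" where
  "massey_product A b m \<alpha> =
     {cohomology_class A b (self_differential A b m a 0 m) | a. defining_system A b m \<alpha> a}"

end

theory Submission
  imports Defs
begin

text \<open>
  The quasi-isomorphism \<open>q\<close> itself supplies the defining system: put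
  \<open>a\<^sub>i\<^sub>j = q\<^bsub>j-i\<^esub>(\<alpha>\<^bsub>i+1\<^esub>, \<dots>, \<alpha>\<^sub>j)\<close> for \<open>i < j\<close>. A path
  \<open>i < k\<^sub>1 < \<dots> < j\<close> is the same thing as a composition of \<open>j - i\<close> (its sequence of steps), so
  the entry \<open>(\<partial>\<^sub>a a)\<^sub>i\<^sub>j\<close> is exactly the composition side of the morphism equation of \<open>q\<close> at
  \<open>\<alpha>\<^bsub>i+1\<^esub>, \<dots>, \<alpha>\<^sub>j\<close> (lemma \<open>self_differential_eq_compositions\<close>).
  On the other side every summand contains some
  \<open>bbar\<^sub>s(\<alpha>\<^bsub>k+1\<^esub>, \<dots>, \<alpha>\<^bsub>k+s\<^esub>)\<close>, which vanishes by hypothesis unless \<open>s = m\<close>. Hence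
  \<open>\<partial>\<^sub>a a\<close> is zero away from the corner, and its corner entry is the single surviving summand
  \<open>q\<^sub>1(bbar\<^sub>m(\<alpha>\<^sub>1, \<dots>, \<alpha>\<^sub>m))\<close>, a representative of \<open>bbar\<^sub>m(\<alpha>\<^sub>1, \<dots>, \<alpha>\<^sub>m)\<close>.

  The morphism equation is given at homogeneous elements only, because of its Koszul signs, whereas the
  classes \<open>\<alpha>\<^sub>i\<close> are arbitrary, and vanishing of \<open>bbar\<^sub>s\<close> at inhomogeneous classes gives no
  vanishing at their homogeneous parts. Lemma \<open>ainf_morphism_equation\<close> removes this
  restriction: the sign in front of the \<open>(r, s, t)\<close> summand amounts to replacing the first \<open>r\<close>
  arguments \<open>x\<close> by their twists \<open>y\<close>, where \<open>y\<close> is \<open>x\<close> with the signs of its odd parts changed.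
  In this form the equation makes sense for all elements and extends by additivity, while the
  argument of \<open>bbar\<^sub>s\<close> stays untwisted, so the vanishing hypothesis still applies.
\<close>

section \<open>Slotwise additive functions\<close>

text \<open>
  The domain is a bare set with an operation, so that the notion applies both to a graded module and to
  the pairs of an element and its twist.
\<close>

definition slotwise_additive ::
  "'p set \<Rightarrow> ('p \<Rightarrow> 'p \<Rightarrow> 'p) \<Rightarrow> ('c, 'z) ring_scheme \<Rightarrow> nat \<Rightarrow> ('p list \<Rightarrow> 'c) \<Rightarrow> bool" where
  "slotwise_additive P pl W n f \<longleftrightarrow>
     (\<forall>xs. length xs = n \<and> set xs \<subseteq> P \<longrightarrow>
        f xs \<in> carrier W \<and>
        (\<forall>i < n. \<forall>x \<in> P. \<forall>y \<in> P. f (xs[i := pl x y]) = f (xs[i := x]) \<oplus>\<^bsub>W\<^esub> f (xs[i := y])))"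

lemma slotwise_additive_closed:
  "slotwise_additive P pl W n f \<Longrightarrow> length xs = n \<Longrightarrow> set xs \<subseteq> P \<Longrightarrow> f xs \<in> carrier W"
  by (simp add: slotwise_additive_def)

lemma slotwise_additive_add:
  "slotwise_additive P pl W n f \<Longrightarrow> length xs = n \<Longrightarrow> set xs \<subseteq> P \<Longrightarrow> i < n \<Longrightarrow> x \<in> P \<Longrightarrow> y \<in> P
    \<Longrightarrow> f (xs[i := pl x y]) = f (xs[i := x]) \<oplus>\<^bsub>W\<^esub> f (xs[i := y])"
  by (simp add: slotwise_additive_def)

lemma multilinear_map_imp_slotwise_additive:
  "multilinear_map K V W n f \<Longrightarrow> slotwise_additive (carrier V) (add V) W n f"
  by (simp add: multilinear_map_def slotwise_additive_def)

lemma graded_multilinear_map_imp_slotwise_additive: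
  "graded_multilinear_map K V W e n f \<Longrightarrow> slotwise_additive (carrier V) (add V) W n f"
  unfolding graded_multilinear_map_def by (blast intro: multilinear_map_imp_slotwise_additive)

lemma slotwise_additive_zero:
  assumes W: "abelian_group W" and V: "abelian_group V"
    and f: "slotwise_additive (carrier V) (add V) W n f"
    and xs: "length xs = n" "set xs \<subseteq> carrier V" and z: "\<zero>\<^bsub>V\<^esub> \<in> set xs"
  shows "f xs = \<zero>\<^bsub>W\<^esub>"
proof -
  interpret W: abelian_group W by fact
  interpret V: abelian_group V by fact
  obtain i where i: "i < n" "xs ! i = \<zero>\<^bsub>V\<^esub>" using z xs by (auto simp: in_set_conv_nth)
  have u: "xs[i := \<zero>\<^bsub>V\<^esub>] = xs" using i by (metis list_update_id)
  have "f xs = f xs \<oplus>\<^bsub>W\<^esub> f xs"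
    using slotwise_additive_add[OF f xs i(1) V.zero_closed V.zero_closed] u by simp
  moreover have "f xs \<in> carrier W" using slotwise_additive_closed[OF f xs] .
  ultimately show ?thesis by (metis W.add.l_cancel_one)
qed

lemma slotwise_additive_minus:
  assumes W: "abelian_group W" and V: "abelian_group V"
    and f: "slotwise_additive (carrier V) (add V) W n f"
    and xs: "length xs = n" "set xs \<subseteq> carrier V" and i: "i < n" and x: "x \<in> carrier V"
  shows "f (xs[i := \<ominus>\<^bsub>V\<^esub> x]) = \<ominus>\<^bsub>W\<^esub> f (xs[i := x])"
proof -
  interpret W: abelian_group W by fact
  interpret V: abelian_group V by fact
  have sub: "set (xs[i := y]) \<subseteq> carrier V" if "y \<in> carrier V" for y
    using xs that by (meson set_update_subsetI)
  have "\<zero>\<^bsub>V\<^esub> \<in> set (xs[i := \<zero>\<^bsub>V\<^esub>])" using i xs by (simp add: set_update_memI)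
  then have "f (xs[i := \<zero>\<^bsub>V\<^esub>]) = \<zero>\<^bsub>W\<^esub>"
    by (intro slotwise_additive_zero[OF W V f]) (use xs sub in auto)
  then have "f (xs[i := \<ominus>\<^bsub>V\<^esub> x]) \<oplus>\<^bsub>W\<^esub> f (xs[i := x]) = \<zero>\<^bsub>W\<^esub>"
    using slotwise_additive_add[OF f xs i, of "\<ominus>\<^bsub>V\<^esub> x" x] x by (simp add: V.l_neg)
  moreover have "f (xs[i := \<ominus>\<^bsub>V\<^esub> x]) \<in> carrier W" "f (xs[i := x]) \<in> carrier W"
    by (intro slotwise_additive_closed[OF f]; use xs sub x in simp)+
  ultimately show ?thesis by (simp add: W.minus_equality)
qed

lemma slotwise_additive_finsum:
  assumes W: "abelian_group W" and S: "finite S"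
    and f: "\<And>s. s \<in> S \<Longrightarrow> slotwise_additive P pl W n (f s)"
    and pl: "\<And>x y. x \<in> P \<Longrightarrow> y \<in> P \<Longrightarrow> pl x y \<in> P"
  shows "slotwise_additive P pl W n (\<lambda>xs. \<Oplus>\<^bsub>W\<^esub>s \<in> S. f s xs)"
proof -
  interpret W: abelian_group W by fact
  have cl: "f s xs \<in> carrier W" if "s \<in> S" "length xs = n" "set xs \<subseteq> P" for s xs
    using slotwise_additive_closed[OF f] that by blast
  have "(\<Oplus>\<^bsub>W\<^esub>s \<in> S. f s (xs[i := pl x y])) =
        (\<Oplus>\<^bsub>W\<^esub>s \<in> S. f s (xs[i := x])) \<oplus>\<^bsub>W\<^esub> (\<Oplus>\<^bsub>W\<^esub>s \<in> S. f s (xs[i := y]))"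
    if xs: "length xs = n" "set xs \<subseteq> P" "i < n" "x \<in> P" "y \<in> P" for xs i x y
  proof -
    have sub: "set (xs[i := z]) \<subseteq> P" if "z \<in> P" for z
      using xs that by (meson set_update_subsetI)
    have "(\<Oplus>\<^bsub>W\<^esub>s \<in> S. f s (xs[i := pl x y])) =
          (\<Oplus>\<^bsub>W\<^esub>s \<in> S. f s (xs[i := x]) \<oplus>\<^bsub>W\<^esub> f s (xs[i := y]))"
      by (rule W.finsum_cong') (use slotwise_additive_add[OF f] xs sub cl in auto)
    also have "\<dots> = (\<Oplus>\<^bsub>W\<^esub>s \<in> S. f s (xs[i := x])) \<oplus>\<^bsub>W\<^esub> (\<Oplus>\<^bsub>W\<^esub>s \<in> S. f s (xs[i := y]))"
      by (rule W.finsum_addf) (use xs sub cl in auto)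
    finally show ?thesis .
  qed
  moreover have "(\<Oplus>\<^bsub>W\<^esub>s \<in> S. f s xs) \<in> carrier W" if "length xs = n" "set xs \<subseteq> P" for xs
    by (rule W.finsum_closed) (use cl that in auto)
  ultimately show ?thesis by (simp add: slotwise_additive_def)
qed

inductive_set sums_of :: "('p \<Rightarrow> 'p \<Rightarrow> 'p) \<Rightarrow> 'p set \<Rightarrow> 'p set" for pl H where
  gen: "p \<in> H \<Longrightarrow> p \<in> sums_of pl H"
| add: "p \<in> sums_of pl H \<Longrightarrow> p' \<in> sums_of pl H \<Longrightarrow> pl p p' \<in> sums_of pl H"

text \<open>
  The set \<open>sums_of pl H\<close> plays the role of the span of the homogeneous elements \<open>H\<close>.
  Going through the slots from left to right, the entry of one slot after the other is allowed to be a
  sum of elements of \<open>H\<close>; within a slot, additivity of both sides carries the equality along the sum.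
\<close>

lemma slotwise_additive_eqI:
  assumes f: "slotwise_additive P pl W n f" and g: "slotwise_additive P pl W n g"
    and pl: "\<And>x y. x \<in> P \<Longrightarrow> y \<in> P \<Longrightarrow> pl x y \<in> P" and H: "H \<subseteq> P"
    and eq: "\<And>ps. length ps = n \<Longrightarrow> set ps \<subseteq> H \<Longrightarrow> f ps = g ps"
    and ps: "length ps = n" "set ps \<subseteq> sums_of pl H"
  shows "f ps = g ps"
proof -
  have T: "p \<in> P" if "p \<in> sums_of pl H" for p
    using that by induction (use H pl in auto)
  have "f ps = g ps" if "k \<le> n" "length ps = n" "set (take k ps) \<subseteq> sums_of pl H" "set (drop k ps) \<subseteq> H"
    for k ps
    using that
  proof (induction k arbitrary: ps)
    case 0
    then show ?case by (simp add: eq)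
  next
    case (Suc k)
    have k: "k < n" using Suc.prems by simp
    have split: "ps = take k ps @ ps ! k # drop (Suc k) ps"
      using k Suc.prems(2) by (simp add: id_take_nth_drop)
    have tk: "set (take k ps) \<subseteq> sums_of pl H" "ps ! k \<in> sums_of pl H"
      using Suc.prems k by (auto simp: take_Suc_conv_app_nth)
    have sub: "set ps \<subseteq> P"
      by (subst split) (use tk Suc.prems(4) H T in auto)
    have "f (ps[k := p]) = g (ps[k := p])" if "p \<in> sums_of pl H" for p
      using that
    proof induction
      case (gen p)
      show ?case
        by (rule Suc.IH)
          (use Suc.prems tk k gen in \<open>auto simp: drop_update_swap Cons_nth_drop_Suc[symmetric]\<close>)
    next
      case (add p p')
      then show ?case
        using slotwise_additive_add[OF f Suc.prems(2) sub k] slotwise_additive_add[OF g Suc.prems(2) sub k] T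
        by simp
    qed
    from this[OF tk(2)] show ?case by simp
  qed
  from this[of n ps] show ?thesis using ps by simp
qed


section \<open>The morphism equation for inhomogeneous elements\<close>

lemma finite_insertions: "finite (insertions n)"
  by (rule finite_subset[of _ "{..n} \<times> {..n} \<times> {..n}"]) (auto simp: insertions_def)

lemma length_le_sum_list: "0 \<notin> set js \<Longrightarrow> length js \<le> sum_list (js :: nat list)"
  by (induction js) auto

lemma finite_compositions: "finite (compositions n)"
  by (rule finite_subset[OF _ finite_lists_length_le[of "{..n}" n]])
    (auto simp: compositions_def length_le_sum_list dest: member_le_sum_list)

definition pair_add :: "('a, 'z) ring_scheme \<Rightarrow> 'a \<times> 'a \<Rightarrow> 'a \<times> 'a \<Rightarrow> 'a \<times> 'a" where
  "pair_add V p p' = (fst p \<oplus>\<^bsub>V\<^esub> fst p', snd p \<oplus>\<^bsub>V\<^esub> snd p')"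

text \<open>
  Pairs consisting of a homogeneous element and the element with its Koszul sign. Additivity is
  used in both components at once, which avoids choosing a sign operator
  \<open>x \<mapsto> y\<close> on the whole module and proving that it is linear.
\<close>

definition twist_pairs :: "('k, 'a, 's) graded_module_scheme \<Rightarrow> ('a \<times> 'a) set" where
  "twist_pairs V = {(x, parity_sign V d x) | x d. x \<in> part V d}"

text \<open>
  The insertion summand with its Koszul sign absorbed: the list \<open>ys\<close> of twists is used to the left of
  the inserted operation, the list \<open>xs\<close> within it and to its right.
\<close>

definition insertion_term ::
  "(nat \<Rightarrow> 'a list \<Rightarrow> 'c) \<Rightarrow> (nat \<Rightarrow> 'a list \<Rightarrow> 'a) \<Rightarrow> nat \<times> nat \<times> nat \<Rightarrow> 'a list \<Rightarrow> 'a list \<Rightarrow> 'c" where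
  "insertion_term f b = (\<lambda>(r, s, t) xs ys.
     f (r + 1 + t) (take r ys @ [b s (take s (drop r xs))] @ drop (r + s) xs))"

text \<open>
  Each slot is used exactly once: to the left of the inserted operation through its second component,
  inside or to the right of it through its first. Additivity thus comes from
  \<open>f\<close>, or from \<open>b\<close> and \<open>f\<close> together.
\<close>

lemma slotwise_additive_insertion_term:
  assumes V: "abelian_group V"
    and b: "\<And>n. n \<ge> 1 \<Longrightarrow> slotwise_additive (carrier V) (add V) V n (b n)"
    and f: "\<And>n. n \<ge> 1 \<Longrightarrow> slotwise_additive (carrier V) (add V) W n (f n)"
    and rst: "(r, s, t) \<in> insertions n"
  shows "slotwise_additive (carrier V \<times> carrier V) (pair_add V) W n
           (\<lambda>ps. insertion_term f b (r, s, t) (map fst ps) (map snd ps))"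
proof -
  interpret V: abelian_group V by fact
  have s: "s \<ge> 1" and n: "r + s + t = n" using rst by (auto simp: insertions_def)
  let ?L = "\<lambda>xs ys. take r ys @ [b s (take s (drop r xs))] @ drop (r + s) xs"
  have bcl: "b s (take s (drop r xs)) \<in> carrier V" if "length xs = n" "set xs \<subseteq> carrier V" for xs
    by (rule slotwise_additive_closed[OF b[OF s]])
      (use that n in \<open>auto dest: in_set_takeD in_set_dropD\<close>)
  have L: "length (?L xs ys) = r + 1 + t" "set (?L xs ys) \<subseteq> carrier V"
    if "length xs = n" "set xs \<subseteq> carrier V" "length ys = n" "set ys \<subseteq> carrier V" for xs ys
    using that n bcl[of xs] by (auto dest: in_set_takeD in_set_dropD)
  have fp: "slotwise_additive (carrier V) (add V) W (r + 1 + t) (f (r + 1 + t))" by (rule f) simp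
  have "f (r + 1 + t) (?L (xs[i := x \<oplus>\<^bsub>V\<^esub> x']) (ys[i := y \<oplus>\<^bsub>V\<^esub> y'])) =
        f (r + 1 + t) (?L (xs[i := x]) (ys[i := y])) \<oplus>\<^bsub>W\<^esub> f (r + 1 + t) (?L (xs[i := x']) (ys[i := y']))"
    if A: "length xs = n" "set xs \<subseteq> carrier V" "length ys = n" "set ys \<subseteq> carrier V" "i < n"
      "x \<in> carrier V" "x' \<in> carrier V" "y \<in> carrier V" "y' \<in> carrier V" for xs ys i x x' y y'
  proof -
    note add = slotwise_additive_add[OF fp L[OF A(1-4)]]
    consider "i < r" | "r \<le> i" "i < r + s" | "r + s \<le> i" by linarith
    then show ?thesis
    proof cases
      case 1
      have "?L (xs[i := u]) (ys[i := v]) = (?L xs ys)[i := v]" for u v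
        using 1 A by (simp add: take_update_swap list_update_append)
      then show ?thesis using add[of i y y'] 1 A by simp
    next
      case 2
      have upd: "?L (xs[i := u]) (ys[i := v]) = (?L xs ys)[r := b s ((take s (drop r xs))[i - r := u])]" for u v
        using 2 A n by (simp add: take_update_swap drop_update_swap list_update_append list_update_beyond)
      have len: "length (take s (drop r xs)) = s" "set (take s (drop r xs)) \<subseteq> carrier V"
        using A n by (auto dest: in_set_takeD in_set_dropD)
      have cl: "b s ((take s (drop r xs))[i - r := u]) \<in> carrier V" if "u \<in> carrier V" for u
        by (rule slotwise_additive_closed[OF b[OF s]])
          (use len set_update_subsetI[OF len(2) that] in \<open>simp_all del: length_take\<close>)
      have "b s ((take s (drop r xs))[i - r := x \<oplus>\<^bsub>V\<^esub> x']) =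
            b s ((take s (drop r xs))[i - r := x]) \<oplus>\<^bsub>V\<^esub> b s ((take s (drop r xs))[i - r := x'])"
        by (rule slotwise_additive_add[OF b[OF s] len]) (use 2 A in auto)
      then show ?thesis unfolding upd using add[of r] cl A by simp
    next
      case 3
      then obtain e where e: "i = r + s + e" using le_Suc_ex by blast
      have "?L (xs[i := u]) (ys[i := v]) = (?L xs ys)[r + 1 + e := u]" for u v
        using e A n by (simp add: drop_update_swap list_update_append)
      then show ?thesis using add[of "r + 1 + e" x x'] e A n by simp
    qed
  qed
  note additive = this
  show ?thesis
    unfolding slotwise_additive_def insertion_term_def prod.case
  proof (intro allI impI conjI ballI)
    fix ps :: "('a \<times> 'a) list" assume ps: "length ps = n \<and> set ps \<subseteq> carrier V \<times> carrier V"
    then have ps': "length (map fst ps) = n" "set (map fst ps) \<subseteq> carrier V"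
      "length (map snd ps) = n" "set (map snd ps) \<subseteq> carrier V" by auto
    show "f (r + 1 + t) (?L (map fst ps) (map snd ps)) \<in> carrier W"
      by (rule slotwise_additive_closed[OF fp L[OF ps']])
    fix i p p' assume "i < n" "p \<in> carrier V \<times> carrier V" "p' \<in> carrier V \<times> carrier V"
    then show "f (r + 1 + t) (?L (map fst (ps[i := pair_add V p p'])) (map snd (ps[i := pair_add V p p']))) =
       f (r + 1 + t) (?L (map fst (ps[i := p])) (map snd (ps[i := p]))) \<oplus>\<^bsub>W\<^esub>
       f (r + 1 + t) (?L (map fst (ps[i := p'])) (map snd (ps[i := p'])))"
      using additive[OF ps', of i "fst p" "fst p'" "snd p" "snd p'"]
      by (simp only: map_update pair_add_def fst_conv snd_conv mem_Times_iff)
  qed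
qed

lemma length_blocks: "length (blocks js xs) = length js"
  by (induction js arbitrary: xs) auto

lemma nth_blocks:
  "sum_list js = length xs \<Longrightarrow> set xs \<subseteq> X \<Longrightarrow> k < length js \<Longrightarrow>
    length (blocks js xs ! k) = js ! k \<and> set (blocks js xs ! k) \<subseteq> X"
proof (induction js arbitrary: xs k)
  case (Cons j js)
  have "set (drop j xs) \<subseteq> X" "set (take j xs) \<subseteq> X"
    using Cons.prems by (auto dest: in_set_dropD in_set_takeD)
  then show ?case using Cons by (cases k) auto
qed simp

text \<open>
  Every slot lies in exactly one block, so changing one entry of the list changes one entry of one block.
\<close>

lemma blocks_update:
  "sum_list js = length xs \<Longrightarrow> i < length xs \<Longrightarrow>
    \<exists>k i'. k < length js \<and> i' < js ! k \<and>
      (\<forall>x. blocks js (xs[i := x]) = (blocks js xs)[k := (blocks js xs ! k)[i' := x]])"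
proof (induction js arbitrary: xs i)
  case (Cons j js)
  show ?case
  proof (cases "i < j")
    case True
    then show ?thesis
      by (intro exI[of _ 0] exI[of _ i]) (simp add: take_update_swap)
  next
    case False
    with Cons.prems have "sum_list js = length (drop j xs)" "i - j < length (drop j xs)" by auto
    from Cons.IH[OF this] obtain k i' where "k < length js" "i' < js ! k"
      "\<forall>x. blocks js ((drop j xs)[i - j := x]) = (blocks js (drop j xs))[k := (blocks js (drop j xs) ! k)[i' := x]]"
      by blast
    then show ?thesis using False
      by (intro exI[of _ "Suc k"] exI[of _ i']) (simp add: drop_update_swap)
  qed
qed simp

lemma slotwise_additive_composition_term:
  assumes g: "\<And>n. n \<ge> 1 \<Longrightarrow> slotwise_additive (carrier W) (add W) W n (g n)"
    and f: "\<And>n. n \<ge> 1 \<Longrightarrow> slotwise_additive (carrier V) (add V) W n (f n)"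
    and js: "js \<in> compositions n" and n: "n \<ge> 1"
  shows "slotwise_additive (carrier V) (add V) W n (\<lambda>xs. g (length js) (map2 f js (blocks js xs)))"
proof -
  have sum: "sum_list js = n" and "0 \<notin> set js" using js by (auto simp: compositions_def)
  then have pos: "js ! k \<ge> 1" if "k < length js" for k
    using nth_mem[OF that] by (metis less_one not_le)
  have gj: "slotwise_additive (carrier W) (add W) W (length js) (g (length js))"
    by (rule g) (use sum n in \<open>cases js; auto\<close>)
  have M: "length (map2 f js (blocks js xs)) = length js" "set (map2 f js (blocks js xs)) \<subseteq> carrier W"
    if xs: "length xs = n" "set xs \<subseteq> carrier V" for xs
  proof -
    show "length (map2 f js (blocks js xs)) = length js" by (simp add: length_blocks)
    show "set (map2 f js (blocks js xs)) \<subseteq> carrier W"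
      using slotwise_additive_closed[OF f[OF pos]] nth_blocks[of js xs "carrier V"] xs sum
      by (auto simp: set_zip length_blocks)
  qed
  show ?thesis
    unfolding slotwise_additive_def
  proof (intro allI impI conjI ballI)
    fix xs assume "length xs = n \<and> set xs \<subseteq> carrier V"
    then have xs: "length xs = n" "set xs \<subseteq> carrier V" by auto
    show "g (length js) (map2 f js (blocks js xs)) \<in> carrier W"
      by (rule slotwise_additive_closed[OF gj M[OF xs]])
    fix i x y assume i: "i < n" and x: "x \<in> carrier V" and y: "y \<in> carrier V"
    obtain k i' where k: "k < length js" and i': "i' < js ! k" and
      upd: "\<And>x. blocks js (xs[i := x]) = (blocks js xs)[k := (blocks js xs ! k)[i' := x]]"
      using blocks_update[of js xs i] sum xs i by auto
    have map2: "map2 f js (blocks js (xs[i := u])) =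
        (map2 f js (blocks js xs))[k := f (js ! k) ((blocks js xs ! k)[i' := u])]" for u
    proof (rule nth_equalityI)
      fix l assume "l < length (map2 f js (blocks js (xs[i := u])))"
      then have "l < length js" by (simp add: length_blocks)
      then show "map2 f js (blocks js (xs[i := u])) ! l =
          (map2 f js (blocks js xs))[k := f (js ! k) ((blocks js xs ! k)[i' := u])] ! l"
        unfolding upd by (cases "l = k") (simp_all add: length_blocks)
    qed (simp add: length_blocks)
    have B: "length (blocks js xs ! k) = js ! k" "set (blocks js xs ! k) \<subseteq> carrier V"
      using nth_blocks[of js xs "carrier V" k] xs sum k by auto
    have cl: "f (js ! k) ((blocks js xs ! k)[i' := u]) \<in> carrier W" if "u \<in> carrier V" for u
      by (rule slotwise_additive_closed[OF f[OF pos[OF k]]])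
        (use B set_update_subsetI[OF B(2) that] in simp_all)
    have "f (js ! k) ((blocks js xs ! k)[i' := x \<oplus>\<^bsub>V\<^esub> y]) =
       f (js ! k) ((blocks js xs ! k)[i' := x]) \<oplus>\<^bsub>W\<^esub> f (js ! k) ((blocks js xs ! k)[i' := y])"
      by (rule slotwise_additive_add[OF f[OF pos[OF k]] B i' x y])
    then show "g (length js) (map2 f js (blocks js (xs[i := x \<oplus>\<^bsub>V\<^esub> y]))) =
       g (length js) (map2 f js (blocks js (xs[i := x]))) \<oplus>\<^bsub>W\<^esub> g (length js) (map2 f js (blocks js (xs[i := y])))"
      unfolding map2 using slotwise_additive_add[OF gj M[OF xs] k cl[OF x] cl[OF y]] by simp
  qed
qed

text \<open>
  This is what absorbs a Koszul sign into the arguments. The prefix \<open>ws\<close> collects the arguments already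
  treated in the induction.
\<close>

lemma slotwise_additive_parity_sign:
  assumes W: "abelian_group W" and V: "abelian_group V"
    and f: "slotwise_additive (carrier V) (add V) W n f"
    and xs: "length (ws @ us @ vs) = n" "set (ws @ us @ vs) \<subseteq> carrier V" and ds: "length ds = length us"
  shows "f (ws @ map2 (parity_sign V) ds us @ vs) = parity_sign W (sum_list ds) (f (ws @ us @ vs))"
  using xs ds
proof (induction us arbitrary: ws ds)
  case Nil
  then show ?case by (simp add: parity_sign_def)
next
  case (Cons u us)
  interpret W: abelian_group W by fact
  interpret V: abelian_group V by fact
  obtain d ds' where ds: "ds = d # ds'" "length ds' = length us"
    using Cons.prems(3) by (cases ds) auto
  let ?u = "parity_sign V d u"
  have u: "u \<in> carrier V" "?u \<in> carrier V" using Cons.prems by (auto simp: parity_sign_def)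
  have cl: "f (ws @ u # us @ vs) \<in> carrier W"
    by (rule slotwise_additive_closed[OF f]) (use Cons.prems in auto)
  have "f (ws @ map2 (parity_sign V) ds (u # us) @ vs) = f ((ws @ [?u]) @ map2 (parity_sign V) ds' us @ vs)"
    by (simp add: ds)
  also have "\<dots> = parity_sign W (sum_list ds') (f ((ws @ [?u]) @ us @ vs))"
    by (rule Cons.IH) (use Cons.prems u ds in auto)
  also have "f ((ws @ [?u]) @ us @ vs) = parity_sign W d (f (ws @ u # us @ vs))"
    using slotwise_additive_minus[OF W V f, of "ws @ u # us @ vs" "length ws" u] Cons.prems u
    by (auto simp: parity_sign_def)
  finally show ?case using cl by (simp add: ds parity_sign_def)
qed

lemma graded_vector_space_abelian_group: "graded_vector_space N K V \<Longrightarrow> abelian_group V"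
  by (simp add: graded_vector_space_def module_def)

lemma graded_vector_space_part_subset: "graded_vector_space N K V \<Longrightarrow> part V d \<subseteq> carrier V"
  unfolding graded_vector_space_def by (meson module.submoduleE(1))

lemma ex_twist:
  assumes V: "graded_vector_space N K V" and x: "x \<in> carrier V"
  shows "\<exists>y. (x, y) \<in> sums_of (pair_add V) (twist_pairs V)"
proof -
  interpret V: abelian_group V using V by (rule graded_vector_space_abelian_group)
  have zero: "\<zero>\<^bsub>V\<^esub> \<in> part V 0"
    using V subgroup.one_closed[OF submodule.axioms(1), of "part V 0" K V]
    by (simp add: graded_vector_space_def)
  obtain c where c: "\<And>d. c d \<in> part V d" "finite {d. c d \<noteq> \<zero>\<^bsub>V\<^esub>}"
    "x = (\<Oplus>\<^bsub>V\<^esub>d \<in> {d. c d \<noteq> \<zero>\<^bsub>V\<^esub>}. c d)"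
    using V x unfolding graded_vector_space_def homogeneous_decomposition_def by metis
  have cl: "c d \<in> carrier V" for d
    using c(1) graded_vector_space_part_subset[OF V] by blast
  have "\<exists>y. ((\<Oplus>\<^bsub>V\<^esub>d \<in> D. c d), y) \<in> sums_of (pair_add V) (twist_pairs V)" if "finite D" for D
    using that
  proof induction
    case empty
    have "(\<zero>\<^bsub>V\<^esub>, parity_sign V 0 \<zero>\<^bsub>V\<^esub>) \<in> twist_pairs V" using zero by (auto simp: twist_pairs_def)
    then show ?case by (auto intro: sums_of.gen)
  next
    case (insert d D)
    then obtain y where y: "((\<Oplus>\<^bsub>V\<^esub>d \<in> D. c d), y) \<in> sums_of (pair_add V) (twist_pairs V)" by blast
    have "(c d, parity_sign V d (c d)) \<in> sums_of (pair_add V) (twist_pairs V)"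
      using c(1) by (auto simp: twist_pairs_def intro: sums_of.gen)
    from sums_of.add[OF this y]
    have "(c d \<oplus>\<^bsub>V\<^esub> (\<Oplus>\<^bsub>V\<^esub>d \<in> D. c d), parity_sign V d (c d) \<oplus>\<^bsub>V\<^esub> y) \<in> sums_of (pair_add V) (twist_pairs V)"
      unfolding pair_add_def[of V "(_, _)"] by simp
    moreover have "(\<Oplus>\<^bsub>V\<^esub>d \<in> insert d D. c d) = c d \<oplus>\<^bsub>V\<^esub> (\<Oplus>\<^bsub>V\<^esub>d \<in> D. c d)"
      using insert cl by (simp add: Pi_def)
    ultimately show ?case by auto
  qed
  from this[OF c(2)] show ?thesis using c(3) by simp
qed

text \<open>
  For homogeneous entries the summand with the twists \<open>y = \<plusminus> x\<close> is the signed summand of the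
  defining equation. Both sides are additive in each slot, and every element is a sum of homogeneous
  ones, so the equation holds for arbitrary entries, with some choice of twists.
\<close>

lemma ainf_morphism_equation:
  fixes V :: "('k, 'a, 's) graded_module_scheme" and W :: "('k, 'c, 't) graded_module_scheme"
  assumes V: "graded_vector_space N K V" and W: "abelian_group W"
    and bV: "\<And>n. n \<ge> 1 \<Longrightarrow> graded_multilinear_map K V V 1 n (bV n)"
    and bW: "\<And>n. n \<ge> 1 \<Longrightarrow> graded_multilinear_map K W W 1 n (bW n)"
    and f: "ainf_morphism K V bV W bW f"
    and xs: "xs \<noteq> []" "set xs \<subseteq> carrier V"
  obtains ys where "length ys = length xs" "set ys \<subseteq> carrier V"
    "(\<Oplus>\<^bsub>W\<^esub>rst \<in> insertions (length xs). insertion_term f bV rst xs ys) =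
     (\<Oplus>\<^bsub>W\<^esub>js \<in> compositions (length xs). bW (length js) (map2 f js (blocks js xs)))"
proof -
  interpret V: abelian_group V using V by (rule graded_vector_space_abelian_group)
  interpret W: abelian_group W by fact
  let ?n = "length xs" and ?P = "carrier V \<times> carrier V" and ?H = "twist_pairs V"
  let ?lhs = "\<lambda>ps. \<Oplus>\<^bsub>W\<^esub>rst \<in> insertions ?n. insertion_term f bV rst (map fst ps) (map snd ps)"
  let ?rhs = "\<lambda>xs. \<Oplus>\<^bsub>W\<^esub>js \<in> compositions ?n. bW (length js) (map2 f js (blocks js xs))"
  have n: "?n \<ge> 1" using xs by (simp add: Suc_le_eq)
  have bV': "slotwise_additive (carrier V) (add V) V n (bV n)" if "n \<ge> 1" for n
    using bV[OF that] by (rule graded_multilinear_map_imp_slotwise_additive)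
  have bW': "slotwise_additive (carrier W) (add W) W n (bW n)" if "n \<ge> 1" for n
    using bW[OF that] by (rule graded_multilinear_map_imp_slotwise_additive)
  have f': "slotwise_additive (carrier V) (add V) W n (f n)" if "n \<ge> 1" for n
    using f that unfolding ainf_morphism_def
    by (blast intro: graded_multilinear_map_imp_slotwise_additive)
  have P: "pair_add V p p' \<in> ?P" if "p \<in> ?P" "p' \<in> ?P" for p p'
    using that by (auto simp: pair_add_def)
  have H: "?H \<subseteq> ?P"
    using graded_vector_space_part_subset[OF V] by (auto simp: twist_pairs_def parity_sign_def)
  have lhs: "slotwise_additive ?P (pair_add V) W ?n ?lhs"
    by (rule slotwise_additive_finsum[OF W finite_insertions _ P])
      (use slotwise_additive_insertion_term[where b = bV and f = f, OF V.abelian_group_axioms bV' f'] in auto)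
  have rhs0: "slotwise_additive (carrier V) (add V) W ?n ?rhs"
    by (rule slotwise_additive_finsum[OF W finite_compositions])
      (use slotwise_additive_composition_term[where g = bW and f = f, OF bW' f' _ n] in auto)
  have rhs: "slotwise_additive ?P (pair_add V) W ?n (\<lambda>ps. ?rhs (map fst ps))"
    unfolding slotwise_additive_def
  proof (intro allI impI conjI ballI)
    fix ps :: "('a \<times> 'a) list" assume "length ps = ?n \<and> set ps \<subseteq> ?P"
    then have ps: "length (map fst ps) = ?n" "set (map fst ps) \<subseteq> carrier V" by auto
    show "?rhs (map fst ps) \<in> carrier W" by (rule slotwise_additive_closed[OF rhs0 ps])
    fix i p p' assume "i < ?n" "p \<in> ?P" "p' \<in> ?P"
    then show "?rhs (map fst (ps[i := pair_add V p p'])) =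
       ?rhs (map fst (ps[i := p])) \<oplus>\<^bsub>W\<^esub> ?rhs (map fst (ps[i := p']))"
      unfolding map_update pair_add_def fst_conv
      by (intro slotwise_additive_add[OF rhs0 ps]) auto
  qed
  have eq: "?lhs ps = ?rhs (map fst ps)" if ps: "length ps = ?n" "set ps \<subseteq> ?H" for ps
  proof -
    have "\<forall>p\<in>set ps. \<exists>d. fst p \<in> part V d \<and> snd p = parity_sign V d (fst p)"
      using ps(2) unfolding twist_pairs_def by fastforce
    then obtain \<delta> where \<delta>: "\<And>p. p \<in> set ps \<Longrightarrow> fst p \<in> part V (\<delta> p) \<and> snd p = parity_sign V (\<delta> p) (fst p)"
      by metis
    let ?xs = "map fst ps" and ?ys = "map snd ps" and ?ds = "map \<delta> ps"
    have hom: "homogeneous_list V ?xs ?ds"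
      unfolding homogeneous_list_def using \<delta> by (simp add: list_all2_conv_all_nth)
    have ys: "?ys = map2 (parity_sign V) ?ds ?xs"
      using \<delta> by (simp add: map_zip_map map_zip_map2 zip_same_conv_map)
    have cl: "set ?xs \<subseteq> carrier V" using ps H by auto
    have "?rhs ?xs = insertion_sum W f bV ?xs ?ds"
    proof -
      have "?xs \<noteq> []" using ps n by auto
      then have "insertion_sum W f bV ?xs ?ds =
          (\<Oplus>\<^bsub>W\<^esub>js \<in> compositions (length ?xs). bW (length js) (map2 f js (blocks js ?xs)))"
        using f hom unfolding ainf_morphism_def by blast
      then show ?thesis by (simp only: length_map ps(1))
    qed
    also have "\<dots> = ?lhs ps"
      unfolding insertion_sum_def length_map ps(1)
    proof (rule W.finsum_cong')
      show "(\<lambda>rst. insertion_term f bV rst ?xs ?ys) \<in> insertions ?n \<rightarrow> carrier W"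
      proof
        fix rst assume rst: "rst \<in> insertions ?n"
        obtain r s t where e: "rst = (r, s, t)" by (cases rst)
        show "insertion_term f bV rst ?xs ?ys \<in> carrier W" unfolding e
          by (rule slotwise_additive_closed[OF slotwise_additive_insertion_term[where b = bV and f = f,
                OF V.abelian_group_axioms bV' f' rst[unfolded e]]])
            (use ps H in auto)
      qed
    next
      fix rst assume "rst \<in> insertions ?n"
      moreover obtain r s t where e: "rst = (r, s, t)" by (cases rst)
      ultimately have s: "s \<ge> 1" and rst: "r + s + t = ?n" by (auto simp: insertions_def)
      let ?vs = "[bV s (take s (drop r ?xs))] @ drop (r + s) ?xs"
      have "bV s (take s (drop r ?xs)) \<in> carrier V"
        by (rule slotwise_additive_closed[OF bV'[OF s]])
          (use cl ps rst in \<open>auto dest: in_set_takeD in_set_dropD simp del: set_map\<close>)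
      then have vs: "set ([] @ take r ?xs @ ?vs) \<subseteq> carrier V"
        using cl by (auto dest: in_set_takeD in_set_dropD simp del: set_map)
      have "f (r + 1 + t) ([] @ map2 (parity_sign V) (take r ?ds) (take r ?xs) @ ?vs) =
        parity_sign W (sum_list (take r ?ds)) (f (r + 1 + t) ([] @ take r ?xs @ ?vs))"
        by (rule slotwise_additive_parity_sign[OF W V.abelian_group_axioms f' _ vs])
          (use ps rst in auto)
      moreover have "map2 (parity_sign V) (take r ?ds) (take r ?xs) = take r ?ys"
        unfolding ys by (simp add: take_map take_zip)
      ultimately show "(case rst of (r, s, t) \<Rightarrow> parity_sign W (sum_list (take r ?ds))
          (f (r + 1 + t) (take r ?xs @ [bV s (take s (drop r ?xs))] @ drop (r + s) ?xs))) =
        insertion_term f bV rst ?xs ?ys"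
        unfolding e insertion_term_def by simp
    qed simp
    finally show ?thesis by simp
  qed
  have "\<forall>x\<in>set xs. \<exists>y. (x, y) \<in> sums_of (pair_add V) ?H"
    using ex_twist[OF V] xs by blast
  then obtain \<epsilon> where \<epsilon>: "\<And>x. x \<in> set xs \<Longrightarrow> (x, \<epsilon> x) \<in> sums_of (pair_add V) ?H" by metis
  let ?ps = "map (\<lambda>x. (x, \<epsilon> x)) xs"
  have T: "p \<in> ?P" if "p \<in> sums_of (pair_add V) ?H" for p
    using that by induction (use H P in auto)
  have "?lhs ?ps = ?rhs (map fst ?ps)"
    by (rule slotwise_additive_eqI[OF lhs rhs P H eq]) (use \<epsilon> in auto)
  moreover have "map fst ?ps = xs" "map snd ?ps = map \<epsilon> xs" by (simp_all add: comp_def)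
  ultimately have "(\<Oplus>\<^bsub>W\<^esub>rst \<in> insertions ?n. insertion_term f bV rst xs (map \<epsilon> xs)) = ?rhs xs"
    by (simp only:)
  moreover have "set (map \<epsilon> xs) \<subseteq> carrier V" using \<epsilon> T by auto
  ultimately show ?thesis by (intro that[of "map \<epsilon> xs"]) simp_all
qed


section \<open>Matrix powers and compositions\<close>

text \<open>
  The steps of the path \<open>i, k\<^sub>1, \<dots>, k\<^sub>n\<^sub>-\<^sub>1, j\<close>; on increasing paths this is a bijection onto the
  compositions of \<open>j - i\<close>, as the next three lemmas show.
\<close>

fun gaps :: "nat \<Rightarrow> nat list \<Rightarrow> nat \<Rightarrow> nat list" where
  "gaps i [] j = [j - i]"
| "gaps i (k # ks) j = (k - i) # gaps k ks j"

lemma gaps_composition: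
  "sorted_wrt (<) (i # ks @ [j]) \<Longrightarrow>
    gaps i ks j \<in> compositions (j - i) \<and> length (gaps i ks j) = Suc (length ks)"
proof (induction ks arbitrary: i)
  case (Cons k ks)
  then have "gaps k ks j \<in> compositions (j - k) \<and> length (gaps k ks j) = Suc (length ks)" by simp
  moreover have "i < k" "k < j" using Cons.prems by auto
  ultimately show ?case by (auto simp: compositions_def)
qed (auto simp: compositions_def)

lemma gaps_inject:
  "sorted_wrt (<) (i # ks @ [j]) \<Longrightarrow> sorted_wrt (<) (i # ks' @ [j]) \<Longrightarrow> length ks = length ks' \<Longrightarrow>
    gaps i ks j = gaps i ks' j \<Longrightarrow> ks = ks'"
proof (induction ks arbitrary: i ks')
  case (Cons k ks)
  then obtain k' ks'' where e: "ks' = k' # ks''" by (cases ks') auto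
  have "k = k'" using Cons.prems by (auto simp: e)
  moreover have "ks = ks''" by (rule Cons.IH[of k]) (use Cons.prems \<open>k = k'\<close> in \<open>auto simp: e\<close>)
  ultimately show ?case by (simp add: e)
qed simp

lemma gaps_surj:
  "js \<noteq> [] \<Longrightarrow> 0 \<notin> set js \<Longrightarrow> i + sum_list js = j \<Longrightarrow>
    \<exists>ks. sorted_wrt (<) (i # ks @ [j]) \<and> length js = Suc (length ks) \<and> gaps i ks j = js"
proof (induction js arbitrary: i)
  case (Cons l js)
  show ?case
  proof (cases "js = []")
    case True
    then show ?thesis using Cons.prems by (intro exI[of _ "[]"]) auto
  next
    case False
    then obtain ks where ks: "sorted_wrt (<) ((i + l) # ks @ [j])" "length js = Suc (length ks)"
      "gaps (i + l) ks j = js"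
      using Cons.IH[of "i + l"] Cons.prems by (auto simp: add.assoc)
    have "i < i + l" using Cons.prems by auto
    then show ?thesis using ks
      by (intro exI[of _ "(i + l) # ks"]) auto
  qed
qed simp

text \<open>
  Cutting \<open>\<alpha>\<^bsub>i+1\<^esub>, \<dots>, \<alpha>\<^sub>j\<close> into blocks of these lengths cuts it at the vertices of
  the path, so applying \<open>q\<close> to the blocks gives the matrix entries along the path.
\<close>

lemma map2_blocks_gaps:
  "sorted_wrt (<) (i # ks @ [j]) \<Longrightarrow>
    map2 q (gaps i ks j) (blocks (gaps i ks j) (map \<alpha> [i + 1..<j + 1])) =
    map2 (\<lambda>i j. q (j - i) (map \<alpha> [i + 1..<j + 1])) (i # ks) (ks @ [j])"
proof (induction ks arbitrary: i)
  case (Cons k ks)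
  have k: "i < k" "k < j" using Cons.prems by auto
  have "[i + 1..<j + 1] = [i + 1..<k + 1] @ [k + 1..<j + 1]"
    using upt_add_eq_append[of "i + 1" "k + 1" "j - k"] k by simp
  then have "map \<alpha> [i + 1..<j + 1] = map \<alpha> [i + 1..<k + 1] @ map \<alpha> [k + 1..<j + 1]"
    by (metis map_append)
  then have "take (k - i) (map \<alpha> [i + 1..<j + 1]) = map \<alpha> [i + 1..<k + 1]"
    "drop (k - i) (map \<alpha> [i + 1..<j + 1]) = map \<alpha> [k + 1..<j + 1]"
    by (simp_all del: upt_Suc)
  then show ?case using Cons by (simp del: upt_Suc)
qed (simp del: upt_Suc)

text \<open>
  A path that is not increasing has a step on or below the diagonal and contributes a zero factor.
\<close>

lemma map2_zero_mem:
  fixes i j :: nat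
  assumes "\<not> sorted_wrt (<) (i # ks @ [j])" and "\<And>i j. j \<le> i \<Longrightarrow> a i j = z"
  shows "z \<in> set (map2 a (i # ks) (ks @ [j]))"
  using assms(1)
proof (induction ks arbitrary: i)
  case (Cons k ks)
  show ?case
  proof (cases "k \<le> i")
    case False
    have "\<not> sorted_wrt (<) (k # ks @ [j])"
    proof
      assume "sorted_wrt (<) (k # ks @ [j])"
      then have "sorted_wrt (<) (i # (k # ks) @ [j])" using False by auto
      then show False using Cons.prems by blast
    qed
    then show ?thesis using Cons.IH by simp
  qed (use assms(2) in simp)
qed (use assms(2) in simp)

lemma set_zip_steps:
  fixes i j :: nat
  shows "sorted_wrt (<) (i # ks @ [j]) \<Longrightarrow> (k, l) \<in> set (zip (i # ks) (ks @ [j])) \<Longrightarrow> k < l \<and> l \<le> j"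
  by (induction ks arbitrary: i) auto

text \<open>
  Only increasing paths contribute to the entry, and they correspond to the compositions of \<open>j - i\<close>.
  A composition has between \<open>1\<close> and \<open>j - i \<le> m\<close> parts, so truncating the sum over the number of
  factors at \<open>m\<close> loses nothing.
\<close>

lemma self_differential_eq_compositions:
  fixes q :: "nat \<Rightarrow> 'b list \<Rightarrow> 'a" and A :: "('k, 'a, 's) graded_module_scheme"
  assumes A: "abelian_group A"
    and b: "\<And>n. n \<ge> 1 \<Longrightarrow> slotwise_additive (carrier A) (add A) A n (b n)"
    and q: "\<And>i j. i < j \<Longrightarrow> j \<le> m \<Longrightarrow> q (j - i) (map \<alpha> [i + 1..<j + 1]) \<in> carrier A"
    and ij: "i \<le> m" "j \<le> m"
  defines "a \<equiv> \<lambda>i j. if i < j \<and> j \<le> m then q (j - i) (map \<alpha> [i + 1..<j + 1]) else \<zero>\<^bsub>A\<^esub>"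
  shows "self_differential A b m a i j =
    (if i < j then (\<Oplus>\<^bsub>A\<^esub>js \<in> compositions (j - i).
        b (length js) (map2 q js (blocks js (map \<alpha> [i + 1..<j + 1])))) else \<zero>\<^bsub>A\<^esub>)"
proof -
  interpret A: abelian_group A by fact
  define F where "F = (\<lambda>js. b (length js) (map2 q js (blocks js (map \<alpha> [i + 1..<j + 1]))))"
  let ?C = "\<lambda>n. {js \<in> compositions (j - i). length js = n}"
  have acl: "a i j \<in> carrier A" for i j using q by (auto simp: a_def)
  have bcl: "b n (map2 a (i # ks) (ks @ [j])) \<in> carrier A" if "n \<ge> 1" "length ks = n - 1" for n ks
    by (rule slotwise_additive_closed[OF b[OF that(1)]]) (use that acl in auto)
  have vanish: "b n (map2 a (i # ks) (ks @ [j])) = \<zero>\<^bsub>A\<^esub>"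
    if "n \<ge> 1" "length ks = n - 1" "\<not> sorted_wrt (<) (i # ks @ [j])" for n ks
    by (rule slotwise_additive_zero[OF A A b[OF that(1)]])
      (use that acl map2_zero_mem[OF that(3), of a "\<zero>\<^bsub>A\<^esub>"] in \<open>auto simp: a_def\<close>)
  show ?thesis
  proof (cases "i < j")
    case False
    have "ainf_power_entry A b m a n i j = \<zero>\<^bsub>A\<^esub>" if "n \<in> {1..m}" for n
      unfolding ainf_power_entry_def
      by (rule A.add.finprod_one_eqI) (use that False vanish in auto)
    then show ?thesis unfolding self_differential_def
      using False by (auto intro: A.add.finprod_one_eqI)
  next
    case True
    have entry: "ainf_power_entry A b m a n i j = (\<Oplus>\<^bsub>A\<^esub>js \<in> ?C n. F js)"
      and Fcl: "F \<in> ?C n \<rightarrow> carrier A" if n: "n \<in> {1..m}" for n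
    proof -
      let ?K = "{ks. length ks = n - 1 \<and> set ks \<subseteq> {0..m}}"
      let ?S = "{ks. length ks = n - 1 \<and> sorted_wrt (<) (i # ks @ [j])}"
      have "finite {ks. set ks \<subseteq> {0..m} \<and> length ks = n - 1}"
        by (rule finite_lists_length_eq) simp
      then have fin: "finite ?K" by (simp add: conj_commute)
      have sub: "?S \<subseteq> ?K" using ij(2) by (fastforce simp: sorted_wrt_append)
      have inj: "inj_on (\<lambda>ks. gaps i ks j) ?S"
        by (rule inj_onI) (use gaps_inject in auto)
      have img: "(\<lambda>ks. gaps i ks j) ` ?S = ?C n"
      proof
        show "(\<lambda>ks. gaps i ks j) ` ?S \<subseteq> ?C n" using gaps_composition[of i _ j] n by auto
        show "?C n \<subseteq> (\<lambda>ks. gaps i ks j) ` ?S"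
        proof
          fix js assume js: "js \<in> ?C n"
          then have "js \<noteq> []" "0 \<notin> set js" "i + sum_list js = j"
            using n True by (auto simp: compositions_def)
          then obtain ks where "sorted_wrt (<) (i # ks @ [j])" "length js = Suc (length ks)" "gaps i ks j = js"
            using gaps_surj[of js i j] by blast
          then have "ks \<in> ?S" "js = gaps i ks j" using js by auto
          then show "js \<in> (\<lambda>ks. gaps i ks j) ` ?S" by (rule rev_image_eqI)
        qed
      qed
      have val: "F (gaps i ks j) = b n (map2 a (i # ks) (ks @ [j]))" if "ks \<in> ?S" for ks
      proof -
        have s: "sorted_wrt (<) (i # ks @ [j])" "length ks = n - 1" using that by auto
        have m2: "map2 (\<lambda>i j. q (j - i) (map \<alpha> [i + 1..<j + 1])) (i # ks) (ks @ [j]) = map2 a (i # ks) (ks @ [j])"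
        proof (rule map_cong[OF refl])
          fix p assume p: "p \<in> set (zip (i # ks) (ks @ [j]))"
          obtain k l where e: "p = (k, l)" by (cases p)
          have "k < l" "l \<le> m" using set_zip_steps[OF s(1)] p ij(2) unfolding e by fastforce+
          then show "(case p of (i, j) \<Rightarrow> q (j - i) (map \<alpha> [i + 1..<j + 1])) = (case p of (i, j) \<Rightarrow> a i j)"
            unfolding e a_def by simp
        qed
        have len: "length (gaps i ks j) = n" using gaps_composition[OF s(1)] s(2) n by simp
        show ?thesis unfolding F_def map2_blocks_gaps[OF s(1), of q \<alpha>] m2 len ..
      qed
      show Fcl: "F \<in> ?C n \<rightarrow> carrier A"
      proof
        fix js assume "js \<in> ?C n"
        then obtain ks where "ks \<in> ?S" "js = gaps i ks j" unfolding img[symmetric] by blast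
        then show "F js \<in> carrier A" using val[of ks] bcl[of n ks] n by simp
      qed
      have "ainf_power_entry A b m a n i j = (\<Oplus>\<^bsub>A\<^esub>ks \<in> ?S. b n (map2 a (i # ks) (ks @ [j])))"
        unfolding ainf_power_entry_def
        by (rule A.add.finprod_mono_neutral_cong_right[OF fin sub])
          (use n vanish bcl in auto)
      also have "\<dots> = (\<Oplus>\<^bsub>A\<^esub>ks \<in> ?S. F (gaps i ks j))"
        by (rule A.finsum_cong') (use val bcl n in auto)
      also have "\<dots> = (\<Oplus>\<^bsub>A\<^esub>js \<in> (\<lambda>ks. gaps i ks j) ` ?S. F js)"
        by (rule A.finsum_reindex[symmetric, OF _ inj]) (use Fcl img in simp)
      finally show "ainf_power_entry A b m a n i j = (\<Oplus>\<^bsub>A\<^esub>js \<in> ?C n. F js)" unfolding img .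
    qed
    have "length js \<in> {1..m}" if "js \<in> compositions (j - i)" for js
      using that length_le_sum_list[of js] True ij by (cases js) (auto simp: compositions_def)
    then have U: "compositions (j - i) = (\<Union>n\<in>{1..m}. ?C n)" by auto
    have "self_differential A b m a i j = (\<Oplus>\<^bsub>A\<^esub>n \<in> {1..m}. \<Oplus>\<^bsub>A\<^esub>js \<in> ?C n. F js)"
      unfolding self_differential_def
      by (rule A.finsum_cong') (use entry Fcl in \<open>auto intro!: A.finsum_closed\<close>)
    also have "\<dots> = (\<Oplus>\<^bsub>A\<^esub>js \<in> (\<Union>n\<in>{1..m}. ?C n). F js)"
      by (rule A.add.finprod_UN_disjoint[symmetric])
        (use finite_compositions Fcl in \<open>auto simp: pairwise_def disjnt_def\<close>)
    finally show ?thesis using U True by (simp add: F_def)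
  qed
qed


section \<open>The defining system given by the quasi-isomorphism\<close>

theorem proposition4p17:
  fixes N :: int
    and K :: "('k, 'r) ring_scheme"
    and A :: "('k, 'a, 's) graded_module_scheme"
    and b :: "nat \<Rightarrow> 'a list \<Rightarrow> 'a"
    and bbar :: "nat \<Rightarrow> 'a set list \<Rightarrow> 'a set"
    and q :: "nat \<Rightarrow> 'a set list \<Rightarrow> 'a"
    and m :: nat
    and \<alpha> :: "nat \<Rightarrow> 'a set"
  assumes "ainf_algebra N K A b"
    and "ainf_structure_on_cohomology N K A b bbar q"
    and "m \<ge> 2"
    and "\<forall>i \<in> {1..m}. \<alpha> i \<in> carrier (cohomology A b)"
    and "\<forall>i j. i < j \<and> j \<le> m \<and> j - i < m \<longrightarrow>
           bbar (j - i) (map \<alpha> [i + 1..<j + 1]) = \<zero>\<^bsub>cohomology A b\<^esub>"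
  shows "massey_defined A b m \<alpha> \<and>
         bbar m (map \<alpha> [1..<m + 1]) \<in> massey_product A b m \<alpha>"
proof -
  let ?H = "cohomology A b"
  have H: "graded_vector_space N K ?H"
    and bbar_graded: "\<And>n. n \<ge> 1 \<Longrightarrow> graded_multilinear_map K ?H ?H 1 n (bbar n)"
    and q_morphism: "ainf_morphism K ?H bbar A b q"
    and lift: "\<And>x. x \<in> carrier ?H \<Longrightarrow> q 1 [x] \<in> cocycles A b \<and> cohomology_class A b (q 1 [x]) = x"
    using assms(2)
    unfolding ainf_structure_on_cohomology_def ainf_algebra_def ainf_quasi_isomorphism_def by simp_all
  have b_graded: "\<And>n. n \<ge> 1 \<Longrightarrow> graded_multilinear_map K A A 1 n (b n)"
    and "graded_vector_space N K A"
    using assms(1) unfolding ainf_algebra_def by simp_all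
  then have Agrp: "abelian_group A" by (simp add: graded_vector_space_abelian_group)
  interpret A: abelian_group A by fact
  interpret H: abelian_group ?H using H by (rule graded_vector_space_abelian_group)
  have b_add: "slotwise_additive (carrier A) (add A) A n (b n)" if "n \<ge> 1" for n
    using b_graded[OF that] by (rule graded_multilinear_map_imp_slotwise_additive)
  have bbar_add: "slotwise_additive (carrier ?H) (add ?H) ?H n (bbar n)" if "n \<ge> 1" for n
    using bbar_graded[OF that] by (rule graded_multilinear_map_imp_slotwise_additive)
  have q_add: "slotwise_additive (carrier ?H) (add ?H) A n (q n)" if "n \<ge> 1" for n
    using q_morphism that unfolding ainf_morphism_def
    by (blast intro: graded_multilinear_map_imp_slotwise_additive)
  have \<alpha>_cl: "set (map \<alpha> [i + 1..<j + 1]) \<subseteq> carrier ?H" if "j \<le> m" for i j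
    using assms(4) that by auto
  have q_cl: "q (j - i) (map \<alpha> [i + 1..<j + 1]) \<in> carrier A" if "i < j" "j \<le> m" for i j
    by (rule slotwise_additive_closed[OF q_add]) (use that \<alpha>_cl[of j i] in auto)
  \<comment> \<open>The corner entry matters too: it supplies the one-part composition of \<open>m\<close>.\<close>
  define a where "a = (\<lambda>i j. if i < j \<and> j \<le> m then q (j - i) (map \<alpha> [i + 1..<j + 1]) else \<zero>\<^bsub>A\<^esub>)"
  \<comment> \<open>The bound \<open>0 + 1\<close> matches the general entry at \<open>i = 0\<close> syntactically.\<close>
  let ?\<beta> = "bbar m (map \<alpha> [0 + 1..<m + 1])"
  have \<beta>: "?\<beta> \<in> carrier ?H"
    by (rule slotwise_additive_closed[OF bbar_add]) (use assms(3) \<alpha>_cl[of m 0] in auto)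
  have diff: "self_differential A b m a i j = (if i = 0 \<and> j = m then q 1 [?\<beta>] else \<zero>\<^bsub>A\<^esub>)"
    if ij: "i < j" "j \<le> m" for i j
  proof -
    let ?xs = "map \<alpha> [i + 1..<j + 1]"
    have len: "length ?xs = j - i" by (simp del: upt_Suc)
    have ne: "?xs \<noteq> []" using ij by auto
    obtain ys where ys: "length ys = length ?xs" "set ys \<subseteq> carrier ?H"
      "(\<Oplus>\<^bsub>A\<^esub>rst \<in> insertions (length ?xs). insertion_term q bbar rst ?xs ys) =
       (\<Oplus>\<^bsub>A\<^esub>js \<in> compositions (length ?xs). b (length js) (map2 q js (blocks js ?xs)))"
      using ainf_morphism_equation[OF H Agrp bbar_graded b_graded q_morphism ne \<alpha>_cl[OF ij(2)]] by blast
    have ins: "insertion_term q bbar (r, s, t) ?xs ys = (if s = m then q 1 [?\<beta>] else \<zero>\<^bsub>A\<^esub>)"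
      if "(r, s, t) \<in> insertions (length ?xs)" for r s t
    proof -
      have s: "s \<ge> 1" and rst: "r + s + t = j - i" using that by (auto simp: insertions_def)
      have sub: "take s (drop r ?xs) = map \<alpha> [(i + r) + 1..<(i + r + s) + 1]"
        using rst ij take_upt[of "i + r + 1" s "j + 1"]
        by (simp add: take_map drop_map add.commute add.left_commute del: upt_Suc)
      show ?thesis
      proof (cases "s = m")
        \<comment> \<open>An insertion of length \<open>m\<close> leaves no other arguments, which forces the corner entry.\<close>
        case True
        then have "r = 0" "t = 0" "i = 0" "j = m" using rst ij by auto
        then show ?thesis using True sub by (simp add: insertion_term_def del: upt_Suc)
      next
        case False
        then have "i + r < i + r + s \<and> i + r + s \<le> m \<and> i + r + s - (i + r) < m"
          using s rst ij by linarith
        then have "bbar (i + r + s - (i + r)) (map \<alpha> [(i + r) + 1..<(i + r + s) + 1]) = \<zero>\<^bsub>?H\<^esub>"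
          by (rule assms(5)[rule_format])
        then have "bbar s (take s (drop r ?xs)) = \<zero>\<^bsub>?H\<^esub>" unfolding sub by simp
        then have "insertion_term q bbar (r, s, t) ?xs ys =
            q (r + 1 + t) (take r ys @ [\<zero>\<^bsub>?H\<^esub>] @ drop (r + s) ?xs)"
          by (simp add: insertion_term_def del: upt_Suc)
        also have "\<dots> = \<zero>\<^bsub>A\<^esub>"
        proof (rule slotwise_additive_zero[OF Agrp H.abelian_group_axioms q_add])
          show "set (take r ys @ [\<zero>\<^bsub>?H\<^esub>] @ drop (r + s) ?xs) \<subseteq> carrier ?H"
            using ys(2) \<alpha>_cl[OF ij(2), of i] set_take_subset[of r ys] set_drop_subset[of "r + s" ?xs]
              H.zero_closed
            by (simp del: upt_Suc set_map) blast
        qed (use ys(1) rst in auto)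
        finally show ?thesis using False by simp
      qed
    qed
    have "self_differential A b m a i j =
        (\<Oplus>\<^bsub>A\<^esub>js \<in> compositions (j - i). b (length js) (map2 q js (blocks js ?xs)))"
      using self_differential_eq_compositions[where q = q and \<alpha> = \<alpha> and i = i and j = j, OF Agrp b_add q_cl] ij
      unfolding a_def by simp
    also have "\<dots> = (\<Oplus>\<^bsub>A\<^esub>rst \<in> insertions (j - i). insertion_term q bbar rst ?xs ys)"
      using ys(3) len by simp
    also have "\<dots> = (\<Oplus>\<^bsub>A\<^esub>rst \<in> insertions (j - i). if rst = (0, m, 0) then q 1 [?\<beta>] else \<zero>\<^bsub>A\<^esub>)"
    proof (rule A.finsum_cong')
      fix rst assume rst: "rst \<in> insertions (j - i)"
      moreover obtain r s t where e: "rst = (r, s, t)" by (cases rst)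
      ultimately have "s = m \<longleftrightarrow> rst = (0, m, 0)" using ij by (auto simp: insertions_def)
      then show "insertion_term q bbar rst ?xs ys = (if rst = (0, m, 0) then q 1 [?\<beta>] else \<zero>\<^bsub>A\<^esub>)"
        using ins[of r s t] rst e len by simp
    qed (use lift[OF \<beta>] in \<open>auto simp: cocycles_def\<close>)
    also have "\<dots> = (if i = 0 \<and> j = m then q 1 [?\<beta>] else \<zero>\<^bsub>A\<^esub>)"
    proof (cases "i = 0 \<and> j = m")
      case True
      then have mem: "(0, m, 0) \<in> insertions (j - i)" using assms(3) by (auto simp: insertions_def)
      have "q 1 [?\<beta>] \<in> carrier A" using lift[OF \<beta>] by (simp add: cocycles_def)
      then have "(\<Oplus>\<^bsub>A\<^esub>rst \<in> insertions (j - i). if rst = (0, m, 0) then q 1 [?\<beta>] else \<zero>\<^bsub>A\<^esub>) = q 1 [?\<beta>]"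
        by (intro A.add.finprod_singleton_swap[OF mem finite_insertions, where f = "\<lambda>_. q 1 [?\<beta>]"]) simp
      then show ?thesis using True by (simp del: upt_Suc)
    next
      case False
      then have "(0, m, 0) \<notin> insertions (j - i)" using ij by (auto simp: insertions_def)
      then have "(\<Oplus>\<^bsub>A\<^esub>rst \<in> insertions (j - i). if rst = (0, m, 0) then q 1 [?\<beta>] else \<zero>\<^bsub>A\<^esub>) = \<zero>\<^bsub>A\<^esub>"
        by (intro A.add.finprod_one_eqI) auto
      then show ?thesis using False by auto
    qed
    finally show ?thesis .
  qed
  have "defining_system A b m \<alpha> a"
    unfolding defining_system_def
  proof (intro conjI ballI)
    show "strictly_upper_triangular A m a"
      using q_cl by (auto simp: strictly_upper_triangular_def a_def simp del: upt_Suc)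
    have "self_differential A b m a i j = \<zero>\<^bsub>A\<^esub>" if "i \<le> m" "j \<le> m" "(i, j) \<noteq> (0, m)" for i j
    proof (cases "i < j")
      case True
      then show ?thesis using diff[of i j] that by auto
    next
      case False
      then show ?thesis
        using self_differential_eq_compositions[where q = q and \<alpha> = \<alpha> and i = i and j = j, OF Agrp b_add q_cl] that
        unfolding a_def by simp
    qed
    then show "agree_off_corner m (self_differential A b m a) (\<lambda>i j. \<zero>\<^bsub>A\<^esub>)"
      by (simp add: agree_off_corner_def)
    fix i assume i: "i \<in> {1..m}"
    then have "a (i - 1) i = q 1 [\<alpha> i]" by (auto simp: a_def)
    then show "a (i - 1) i \<in> cocycles A b" "cohomology_class A b (a (i - 1) i) = \<alpha> i"
      using lift assms(4) i by auto
  qed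
  moreover have "cohomology_class A b (self_differential A b m a 0 m) = bbar m (map \<alpha> [1..<m + 1])"
    using diff[of 0 m] assms(3) lift[OF \<beta>] by simp
  ultimately show ?thesis
    unfolding massey_defined_def massey_product_def by blast
qed

end
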